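(* Over $\mathbb F_4$ let $\tilde H=\begin{pmatrix}1&0&1&1\\0&1&1&w\end{pmatrix}$ and let $H$ be the $13\times 20$ matrix $$H=\left(\begin{array}{c} I_5\otimes\tilde H\\ \hline A_1\;A_2\;A_3\;A_4\;A_5\end{array}\right),\qquad A_i=\begin{pmatrix}\mathbf 0&\mathbf 0&\mathbf u_i&\mathbf v_i\end{pmatrix}\in\mathbb F_4^{3\times4},$$ where $\mathbf u_1=(0,0,1)^T$, $\mathbf v_1=(0,1,w^2)^T$; $\mathbf u_2=(1,0,0)^T$, $\mathbf v_2=(w^2,1,0)^T$; $\mathbf u_3=(1,0,1)^T$, $\mathbf v_3=(w^2,1,w^2)^T$; $\mathbf u_4=(1,0,w)^T$, $\mathbf v_4=(w^2,1,1)^T$; $\mathbf u_5=(1,0,w^2)^T$, $\mathbf v_5=(w^2,1,w)^T$. Then the linear code with parity-check matrix $H$ is an optimal quaternary $[20,7,8]$ $(r,\delta)$-LRC code with $r=2$, $\delta=3$. Moreover, deleting from $H$, for any one $i\in\{1,\dots,5\}$, the $i$-th block of four columns together with the two rows of $I_5\otimes\tilde H$ supported on that block gives a parity-check matrix of an optimal quaternary $[16,5,8]$ $(r,\delta)$-LRC code with $r=2$, $\delta=3$.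
   Context: $\mathbb F_4=\{0,1,w,w^2\}$ with $w^2=w+1$, $w^3=1$; $I_m$ is the $m\times m$ identity matrix and $\otimes$ the Kronecker product. For a linear code $\mathcal C\subseteq\mathbb{F}_q^n$ and $R\subseteq[n]=\{1,\dots,n\}$, $\mathcal C|_R$ is the code obtained by puncturing (deleting) the coordinates outside $R$. An $[n,k,d]$ linear code $\mathcal C$ is an $(r,\delta)$-LRC code if for every $i\in[n]$ there is $R_i\subseteq[n]$ with $i\in R_i$, $|R_i|\le r+\delta-1$, such that $\mathcal C|_{R_i}$ has minimum distance at least $\delta$ (every nonzero word has weight at least $\delta$). Every such code satisfies $d\le n-k+1-(\lceil k/r\rceil-1)(\delta-1)$; it is $d$-optimal if equality holds. An $(r,\delta)$-LRC code is $r$-optimal if it is not an $(r',\delta)$-LRC code for any $1\le r'<r$. "Optimal $(r,\delta)$-LRC code" means an $(r,\delta)$-LRC code that is both $d$-optimal and $r$-optimal, with $d\ge\delta>2$ and $k>r\ge1$. *)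

theory Defs
  imports
    "Jordan_Normal_Form.Matrix_Kernel"
    "Jordan_Normal_Form.DL_Submatrix"
    Complex_Main
begin

section \<open>The field with four elements\<close>

datatype gf4 = GF4_0 | GF4_1 | GF4_w | GF4_w2

instantiation gf4 :: field
begin

definition zero_gf4 :: gf4 where "0 = GF4_0"

definition one_gf4 :: gf4 where "1 = GF4_1"

fun plus_gf4 :: "gf4 \<Rightarrow> gf4 \<Rightarrow> gf4" where
  "GF4_0 + y = y"
| "x + GF4_0 = x"
| "GF4_1 + GF4_1 = GF4_0"
| "GF4_1 + GF4_w = GF4_w2"
| "GF4_1 + GF4_w2 = GF4_w"
| "GF4_w + GF4_1 = GF4_w2"
| "GF4_w + GF4_w = GF4_0"
| "GF4_w + GF4_w2 = GF4_1"
| "GF4_w2 + GF4_1 = GF4_w"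
| "GF4_w2 + GF4_w = GF4_1"
| "GF4_w2 + GF4_w2 = GF4_0"

fun times_gf4 :: "gf4 \<Rightarrow> gf4 \<Rightarrow> gf4" where
  "GF4_0 * y = GF4_0"
| "x * GF4_0 = GF4_0"
| "GF4_1 * y = y"
| "x * GF4_1 = x"
| "GF4_w * GF4_w = GF4_w2"
| "GF4_w * GF4_w2 = GF4_1"
| "GF4_w2 * GF4_w = GF4_1"
| "GF4_w2 * GF4_w2 = GF4_w"

definition uminus_gf4 :: "gf4 \<Rightarrow> gf4" where "- x = (x :: gf4)"

definition minus_gf4 :: "gf4 \<Rightarrow> gf4 \<Rightarrow> gf4" where "x - y = (x + y :: gf4)"

fun inverse_gf4 :: "gf4 \<Rightarrow> gf4" where
  "inverse GF4_0 = GF4_0"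
| "inverse GF4_1 = GF4_1"
| "inverse GF4_w = GF4_w2"
| "inverse GF4_w2 = GF4_w"

definition divide_gf4 :: "gf4 \<Rightarrow> gf4 \<Rightarrow> gf4" where "x div y = x * inverse (y :: gf4)"

instance
proof
  fix a b c :: gf4
  show "a + b + c = a + (b + c)" by (cases a; cases b; cases c) simp_all
  show "a + b = b + a" by (cases a; cases b) simp_all
  show "0 + a = a" by (simp add: zero_gf4_def)
  show "- a + a = 0" by (cases a) (simp_all add: zero_gf4_def uminus_gf4_def)
  show "a - b = a + - b" by (simp add: minus_gf4_def uminus_gf4_def)
  show "a * b * c = a * (b * c)" by (cases a; cases b; cases c) simp_all
  show "a * b = b * a" by (cases a; cases b) simp_all
  show "1 * a = a" by (cases a) (simp_all add: one_gf4_def)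
  show "(a + b) * c = a * c + b * c" by (cases a; cases b; cases c) simp_all
  show "(0 :: gf4) \<noteq> 1" by (simp add: zero_gf4_def one_gf4_def)
  show "a \<noteq> 0 \<Longrightarrow> inverse a * a = 1" by (cases a) (simp_all add: zero_gf4_def one_gf4_def)
  show "a div b = a * inverse b" by (simp add: divide_gf4_def)
  show "inverse (0 :: gf4) = 0" by (simp add: zero_gf4_def)
qed

end

abbreviation w :: gf4 where "w \<equiv> GF4_w"

lemma gf4_w_square: "w\<^sup>2 = w + 1"
  by (simp add: power2_eq_square one_gf4_def)

lemma gf4_w_cube: "w ^ 3 = 1"
  by (simp add: power3_eq_cube one_gf4_def)

lemma UNIV_gf4: "(UNIV :: gf4 set) = {0, 1, w, w\<^sup>2}"
  by (auto simp: power2_eq_square zero_gf4_def one_gf4_def) (metis gf4.exhaust)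

lemma card_UNIV_gf4: "card (UNIV :: gf4 set) = 4"
  unfolding UNIV_gf4 by (simp add: power2_eq_square zero_gf4_def one_gf4_def)


section \<open>Linear codes\<close>

text \<open>Coordinates are numbered from 0, so the coordinate set of a code of length
  \<open>n\<close> is \<open>{0..<n}\<close>.\<close>

definition linear_code :: "nat \<Rightarrow> 'a :: field vec set \<Rightarrow> bool" where
  "linear_code n C \<longleftrightarrow> VectorSpace.subspace class_ring C (module_vec TYPE('a) n)"

definition code_dim :: "nat \<Rightarrow> 'a :: field vec set \<Rightarrow> nat" where
  "code_dim n C = vectorspace.dim class_ring ((module_vec TYPE('a) n)\<lparr>carrier := C\<rparr>)"

definition hamming_weight :: "'a :: zero vec \<Rightarrow> nat" where
  "hamming_weight c = card {i. i < dim_vec c \<and> c $ i \<noteq> 0}"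

text \<open>The set of weights below is empty only for the zero code (and then \<open>Inf {} = 0\<close>).\<close>

definition min_distance :: "'a :: zero vec set \<Rightarrow> nat" where
  "min_distance C = Inf {hamming_weight c | c. c \<in> C \<and> c \<noteq> 0\<^sub>v (dim_vec c)}"

text \<open>The zero code has minimum distance at least \<open>\<delta>\<close> for every \<open>\<delta>\<close>, which is why
  this is not stated through \<^const>\<open>min_distance\<close>.\<close>

definition min_distance_ge :: "'a :: zero vec set \<Rightarrow> nat \<Rightarrow> bool" where
  "min_distance_ge C \<delta> \<longleftrightarrow> (\<forall>c\<in>C. c \<noteq> 0\<^sub>v (dim_vec c) \<longrightarrow> \<delta> \<le> hamming_weight c)"

definition nkd_code :: "nat \<Rightarrow> nat \<Rightarrow> nat \<Rightarrow> 'a :: field vec set \<Rightarrow> bool" where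
  "nkd_code n k d C \<longleftrightarrow> linear_code n C \<and> code_dim n C = k \<and> min_distance C = d"

text \<open>Deletion of the coordinates outside \<open>R\<close>, in the style of \<^const>\<open>submatrix\<close>:
  \<^term>\<open>pick R i\<close> is the \<open>i\<close>-th smallest element of \<open>R\<close>.\<close>

definition subvec :: "'a vec \<Rightarrow> nat set \<Rightarrow> 'a vec" where
  "subvec c R = vec (card {i. i < dim_vec c \<and> i \<in> R}) (\<lambda>i. c $ pick R i)"

definition restrict_code :: "'a vec set \<Rightarrow> nat set \<Rightarrow> 'a vec set" where
  "restrict_code C R = (\<lambda>c. subvec c R) ` C"


section \<open>Locally repairable codes\<close>

definition LRC :: "nat \<Rightarrow> nat \<Rightarrow> nat \<Rightarrow> 'a :: field vec set \<Rightarrow> bool" where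
  "LRC n r \<delta> C \<longleftrightarrow> linear_code n C \<and>
    (\<forall>i\<in>{0..<n}. \<exists>R. R \<subseteq> {0..<n} \<and> i \<in> R \<and> card R \<le> r + \<delta> - 1 \<and>
      min_distance_ge (restrict_code C R) \<delta>)"

definition d_optimal :: "nat \<Rightarrow> nat \<Rightarrow> nat \<Rightarrow> nat \<Rightarrow> nat \<Rightarrow> bool" where
  "d_optimal n k d r \<delta> \<longleftrightarrow>
    int d = int n - int k + 1 - (\<lceil>real k / real r\<rceil> - 1) * (int \<delta> - 1)"

definition r_optimal :: "nat \<Rightarrow> nat \<Rightarrow> nat \<Rightarrow> 'a :: field vec set \<Rightarrow> bool" where
  "r_optimal n r \<delta> C \<longleftrightarrow> (\<forall>r'. 1 \<le> r' \<and> r' < r \<longrightarrow> \<not> LRC n r' \<delta> C)"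

definition optimal_LRC ::
    "nat \<Rightarrow> nat \<Rightarrow> nat \<Rightarrow> nat \<Rightarrow> nat \<Rightarrow> 'a :: field vec set \<Rightarrow> bool" where
  "optimal_LRC n k d r \<delta> C \<longleftrightarrow>
    nkd_code n k d C \<and> LRC n r \<delta> C \<and> d_optimal n k d r \<delta> \<and> r_optimal n r \<delta> C \<and>
    d \<ge> \<delta> \<and> \<delta> > 2 \<and> k > r \<and> r \<ge> 1"


section \<open>The parity-check matrices\<close>

definition kronecker :: "'a :: semiring_0 mat \<Rightarrow> 'a mat \<Rightarrow> 'a mat" (infixl \<open>\<otimes>\<^sub>K\<close> 70) where
  "A \<otimes>\<^sub>K B = mat (dim_row A * dim_row B) (dim_col A * dim_col B)
    (\<lambda>(i, j). A $$ (i div dim_row B, j div dim_col B) * B $$ (i mod dim_row B, j mod dim_col B))"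

definition H_tilde :: "gf4 mat" where
  "H_tilde = mat_of_rows_list 4
    [[1, 0, 1, 1],
     [0, 1, 1, w]]"

definition u_vec :: "nat \<Rightarrow> gf4 vec" where
  "u_vec i = vec_of_list
    ([[0, 0, 1], [1, 0, 0], [1, 0, 1], [1, 0, w], [1, 0, w\<^sup>2]] ! (i - 1))"

definition v_vec :: "nat \<Rightarrow> gf4 vec" where
  "v_vec i = vec_of_list
    ([[0, 1, w\<^sup>2], [w\<^sup>2, 1, 0], [w\<^sup>2, 1, w\<^sup>2], [w\<^sup>2, 1, 1], [w\<^sup>2, 1, w]] ! (i - 1))"

definition A_block :: "nat \<Rightarrow> gf4 mat" where
  "A_block i = mat_of_cols 3 [0\<^sub>v 3, 0\<^sub>v 3, u_vec i, v_vec i]"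

definition H_matrix :: "gf4 mat" where
  "H_matrix = (1\<^sub>m 5 \<otimes>\<^sub>K H_tilde) @\<^sub>r
    mat_of_cols 3 (concat (map (\<lambda>i. cols (A_block i)) [1, 2, 3, 4, 5]))"

text \<open>The \<open>i\<close>-th column block (\<open>i = 1, \<dots>, 5\<close>) consists of the columns with 0-based indices
  \<open>4 (i - 1), \<dots>, 4 i - 1\<close>; the rows of \<^term>\<open>1\<^sub>m 5 \<otimes>\<^sub>K H_tilde\<close> supported on it are those with
  0-based indices \<open>2 (i - 1)\<close> and \<open>2 i - 1\<close>.\<close>

definition H_deleted :: "nat \<Rightarrow> gf4 mat" where
  "H_deleted i = submatrix H_matrix (- {2 * (i - 1)..<2 * i}) (- {4 * (i - 1)..<4 * i})"

text \<open>The code with parity-check matrix \<open>H\<close> is \<^term>\<open>mat_kernel H\<close>.\<close>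

end

(* The code is a generalized concatenation.  The inner [4,2,3] code with parity-check matrix
   H_tilde has the basis (1,1,1,0), (w,1,w^2,1), and all nonzero multiples of the second vector
   have weight 4.  If the t-th block of a word is p_t (1,1,1,0) + q_t (w,1,w^2,1), then the last
   three rows of H say that sum q_t = 0 and sum p_t g_t = 0, where the g_t are the pairwise
   non-proportional vectors (0,1), (1,0), (1,1), (1,w), (1,w^2).  Hence a codeword with p nonzero
   has at least three nonzero blocks and weight at least 9, and one with p = 0 has at least two
   blocks of weight 4.  Deleting a block leaves this structure intact.  Locality r = 1 fails because
   for every j > 0 some codeword vanishes at coordinate j but not at coordinate 0. *)

theory Submission
  imports Defs
begin

section \<open>Arithmetic in the field with four elements\<close>

text \<open>Reduces constants, signs and squares to the four constructors; after a case split the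
  tables of \<open>+\<close> and \<open>*\<close> decide any identity.\<close>

lemmas gf4_arith = zero_gf4_def one_gf4_def uminus_gf4_def minus_gf4_def power2_eq_square

lemma gf4_add_self [simp]: "(a :: gf4) + a = 0"
  by (cases a) (simp_all add: gf4_arith)

text \<open>Simplification collects equal summands to \<open>2 * a\<close>; this form of
  characteristic 2 removes them.\<close>

lemma gf4_two: "(2 :: gf4) = 0"
  by (metis gf4_add_self one_add_one)

lemma gf4_add_eq_0_iff: "(a :: gf4) + b = 0 \<longleftrightarrow> a = b"
  by (cases a; cases b) (simp_all add: gf4_arith)

section \<open>Restricted words and kernels of matrices\<close>

lemma hamming_weight_eq_0_iff: "hamming_weight c = 0 \<longleftrightarrow> c = 0\<^sub>v (dim_vec c)"
  unfolding hamming_weight_def by (auto simp: vec_eq_iff)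

text \<open>With weight 0 in place of the zero vector, a restricted word enters only through its
  weight.\<close>

lemma min_distance_ge_iff:
  "min_distance_ge C \<delta> \<longleftrightarrow> (\<forall>c\<in>C. hamming_weight c = 0 \<or> \<delta> \<le> hamming_weight c)"
  unfolding min_distance_ge_def hamming_weight_eq_0_iff by auto

lemma bij_betw_pick:
  assumes "finite R"
  shows "bij_betw (pick R) {..<card R} R"
proof (rule bij_betwI')
  fix x y assume "x \<in> {..<card R}" "y \<in> {..<card R}"
  then show "pick R x = pick R y \<longleftrightarrow> x = y"
    by (metis lessThan_iff nat_neq_iff pick_mono_le)
next
  fix x assume "x \<in> {..<card R}"
  then show "pick R x \<in> R" by (simp add: pick_in_set_le)
next
  fix y assume y: "y \<in> R"
  have "{a\<in>R. a < y} \<subset> R" using y by auto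
  with assms have "card {a\<in>R. a < y} < card R" by (rule psubset_card_mono)
  then show "\<exists>x\<in>{..<card R}. y = pick R x"
    using pick_card_in_set[OF y] by (metis lessThan_iff)
qed

text \<open>Counting in the original coordinates removes \<open>pick\<close> from all later weight
  arguments.\<close>

lemma hamming_weight_subvec:
  assumes "R \<subseteq> {0..<dim_vec c}"
  shows "hamming_weight (subvec c R) = card {i\<in>R. c $ i \<noteq> 0}"
proof -
  have fin: "finite R" using assms finite_subset by blast
  have R: "{i. i < dim_vec c \<and> i \<in> R} = R" using assms by auto
  have "{i\<in>R. c $ i \<noteq> 0} = pick R ` {k. k < card R \<and> c $ pick R k \<noteq> 0}"
    using bij_betw_imp_surj_on[OF bij_betw_pick[OF fin]] by auto
  moreover have "inj_on (pick R) {k. k < card R \<and> c $ pick R k \<noteq> 0}"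
    by (rule inj_on_subset[OF bij_betw_imp_inj_on[OF bij_betw_pick[OF fin]]]) auto
  ultimately have "card {i\<in>R. c $ i \<noteq> 0} = card {k. k < card R \<and> c $ pick R k \<noteq> 0}"
    by (simp add: card_image)
  also have "{k. k < card R \<and> c $ pick R k \<noteq> 0} =
      {k. k < dim_vec (subvec c R) \<and> subvec c R $ k \<noteq> 0}"
    unfolding subvec_def R by auto
  finally show ?thesis unfolding hamming_weight_def by simp
qed

lemma linear_code_mat_kernel:
  fixes A :: "'a :: field mat"
  assumes A: "A \<in> carrier_mat nr nc"
  shows "linear_code nc (mat_kernel A)"
proof -
  interpret vec_space "TYPE('a)" nc .
  show ?thesis unfolding linear_code_def
    by (intro subspace.intro vec_vs submodule.intro)
       (insert A mult_add_distrib_mat_vec[OF A] mult_mat_vec[OF A] mat_kernel[OF A],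
        auto simp: class_ring_simps module_vec_simps module_axioms)
qed

text \<open>Rank-nullity, with full rank expressed as surjectivity: preimages can be written down,
  so no rank has to be computed.\<close>

lemma code_dim_mat_kernel:
  fixes A :: "'a :: field mat"
  assumes A: "A \<in> carrier_mat nr nc"
    and surj: "\<And>z. z \<in> carrier_vec nr \<Longrightarrow> \<exists>c\<in>carrier_vec nc. A *\<^sub>v c = z"
  shows "code_dim nc (mat_kernel A) + nr = nc"
proof -
  interpret V: vec_space "TYPE('a)" nc .
  interpret W: vec_space "TYPE('a)" nr .
  interpret L: linear_map class_ring V.V W.V "\<lambda>c. A *\<^sub>v c"
  proof (intro linear_map.intro mod_hom.intro mod_hom_axioms.intro)
    show "(*\<^sub>v) A \<in> LinearCombinations.module_hom class_ring V.V W.V"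
      using mult_add_distrib_mat_vec[OF A] mult_mat_vec[OF A] A
      unfolding LinearCombinations.module_hom_def by (auto simp: module_vec_simps class_ring_simps)
  qed (fact V.vectorspace_axioms W.vectorspace_axioms V.module_axioms W.module_axioms)+
  have im: "L.im = carrier W.V"
    using A surj by (auto simp: L.im_def module_vec_simps image_iff)
  have ker: "L.kerT = mat_kernel A"
    using A by (auto simp: L.ker_def mat_kernel module_vec_simps)
  have "W.dim + code_dim nc (mat_kernel A) = V.dim"
    using L.rank_nullity[OF V.fin_dim] unfolding im ker code_dim_def by (simp add: module_vec_def)
  then show ?thesis using V.dim_is_n W.dim_is_n by simp
qed

section \<open>The parity-check matrices in block form\<close>

text \<open>\<open>u\<^sub>i = (\<alpha>\<^sub>i, 0, \<beta>\<^sub>i)\<close> and \<open>v\<^sub>i = (0, 1, 0) + w\<^sup>2 u\<^sub>i\<close>.\<close>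

definition alpha :: "nat \<Rightarrow> gf4" where
  "alpha i = (if i = 1 then 0 else 1)"

definition beta :: "nat \<Rightarrow> gf4" where
  "beta i = [1, 0, 1, w, w\<^sup>2] ! (i - 1)"

lemma atLeastAtMost_1_5: "{1..5 :: nat} = {1, 2, 3, 4, 5}"
  by auto

text \<open>The pairs \<open>(alpha i, beta i)\<close> represent the five points of the projective
  line over the field; the left-hand side is the determinant of two of them.\<close>

lemma alpha_beta_det:
  assumes "i \<in> {1..5}" "j \<in> {1..5}" "i \<noteq> j"
  shows "alpha i * beta j + alpha j * beta i \<noteq> 0"
  using assms unfolding atLeastAtMost_1_5
  by (auto simp: alpha_def beta_def gf4_arith)

text \<open>Cramer's rule; in characteristic 2 its minus signs become plus signs, and the mixed
  products occur twice and cancel.\<close>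

lemma alpha_beta_solve:
  assumes "i \<in> {1..5}" "j \<in> {1..5}" "i \<noteq> j"
  obtains x y where "alpha i * x + alpha j * y = a" "beta i * x + beta j * y = b"
proof
  let ?D = "alpha i * beta j + alpha j * beta i"
  have D: "?D \<noteq> 0" using alpha_beta_det[OF assms] .
  show "alpha i * ((beta j * a + alpha j * b) / ?D) + alpha j * ((beta i * a + alpha i * b) / ?D) = a"
  proof -
    have "alpha i * (beta j * a + alpha j * b) + alpha j * (beta i * a + alpha i * b) =
        ?D * a + (alpha i * alpha j * b + alpha i * alpha j * b)"
      by (simp only: algebra_simps)
    then show ?thesis using D by (simp add: add_divide_distrib[symmetric])
  qed
  show "beta i * ((beta j * a + alpha j * b) / ?D) + beta j * ((beta i * a + alpha i * b) / ?D) = b"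
  proof -
    have "beta i * (beta j * a + alpha j * b) + beta j * (beta i * a + alpha i * b) =
        ?D * b + (beta i * beta j * a + beta i * beta j * a)"
      by (simp only: algebra_simps)
    then show ?thesis using D by (simp add: add_divide_distrib[symmetric])
  qed
qed

lemma A_block_index:
  assumes "i \<in> {1..5}" "s < 3" "k < 4"
  shows "A_block i $$ (s, k) = [0, 0, [alpha i, 0, beta i] ! s, [w\<^sup>2 * alpha i, 1, w\<^sup>2 * beta i] ! s] ! k"
proof -
  have s: "s \<in> {0, 1, 2}" and k: "k \<in> {0, 1, 2, 3}" using assms by auto
  have u: "u_vec i $ s = [alpha i, 0, beta i] ! s"
    and v: "v_vec i $ s = [w\<^sup>2 * alpha i, 1, w\<^sup>2 * beta i] ! s"
    using assms(1) s unfolding atLeastAtMost_1_5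
    by (auto simp: u_vec_def v_vec_def alpha_def beta_def vec_of_list_index gf4_arith)
  have "A_block i $$ (s, k) = [0\<^sub>v 3, 0\<^sub>v 3, u_vec i, v_vec i] ! k $ s"
    using assms by (simp add: A_block_def mat_of_cols_index)
  then show ?thesis using k assms(2) u v by auto
qed

lemma H_tilde_index:
  assumes "s < 2" "k < 4"
  shows "H_tilde $$ (s, k) = [[1, 0, 1, 1], [0, 1, 1, w]] ! s ! k"
  using assms by (simp add: H_tilde_def mat_of_rows_list_def)

text \<open>An element is recovered by \<open>pick\<close> from the number of smaller elements, so
  it suffices to count those below the claimed value.\<close>

lemma pick_Compl_atLeastLessThan:
  assumes "a \<le> b"
  shows "pick (- {a..<b}) k = (if k < a then k else k + (b - a))"
proof -
  let ?i = "if k < a then k else k + (b - a)"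
  have "{x \<in> - {a..<b}. x < ?i} = (if k < a then {..<k} else {..<a} \<union> {b..<k + (b - a)})"
    using assms by auto
  moreover have "card ({..<a} \<union> {b..<k + (b - a)}) = a + (k - a)"
    using assms by (subst card_Un_disjoint) auto
  ultimately have "card {x \<in> - {a..<b}. x < ?i} = k" by simp
  moreover have "?i \<in> - {a..<b}" using assms by auto
  ultimately show ?thesis using pick_card_in_set[of ?i "- {a..<b}"] by simp
qed

text \<open>One shape for \<open>H_matrix\<close> and its deletions: \<open>b t\<close> is the
  number, from 1 to 5, of the original block now at position \<open>t\<close>.\<close>

definition block_matrix :: "nat \<Rightarrow> (nat \<Rightarrow> nat) \<Rightarrow> gf4 mat" where
  "block_matrix m b = mat (2 * m + 3) (4 * m) (\<lambda>(r, j).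
    if r < 2 * m then (if r div 2 = j div 4 then H_tilde $$ (r mod 2, j mod 4) else 0)
    else A_block (b (j div 4)) $$ (r - 2 * m, j mod 4))"

lemma block_matrix_carrier [simp]: "block_matrix m b \<in> carrier_mat (2 * m + 3) (4 * m)"
  by (simp add: block_matrix_def)

lemma H_matrix_eq: "H_matrix = block_matrix 5 Suc"
proof -
  let ?B = "mat_of_cols 3 (concat (map (\<lambda>i. cols (A_block i)) [1, 2, 3, 4, 5]))"
  let ?z = "0\<^sub>v 3 :: gf4 vec"
  have uv: "u_vec i \<in> carrier_vec 3" "v_vec i \<in> carrier_vec 3" if "i \<in> {1..5}" for i
    using that unfolding atLeastAtMost_1_5
    by (auto simp: u_vec_def v_vec_def intro!: carrier_vecI)
  have "cols (A_block i) = [?z, ?z, u_vec i, v_vec i]" if "i \<in> {1..5}" for i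
    using uv[OF that] unfolding A_block_def by (subst cols_mat_of_cols) auto
  \<comment> \<open>Listing all 20 columns allows a comparison of entries by cases on block and
    column.\<close>
  then have B: "?B = mat_of_cols 3 [?z, ?z, u_vec 1, v_vec 1, ?z, ?z, u_vec 2, v_vec 2,
      ?z, ?z, u_vec 3, v_vec 3, ?z, ?z, u_vec 4, v_vec 4, ?z, ?z, u_vec 5, v_vec 5]"
    by simp
  have B_index: "?B $$ (s, j) = A_block (Suc (j div 4)) $$ (s, j mod 4)"
    if s: "s < 3" and j: "j < 20" for s j
  proof -
    define t k where "t = j div 4" and "k = j mod 4"
    have tk: "t \<in> {0, 1, 2, 3, 4}" "k \<in> {0, 1, 2, 3}" "j = 4 * t + k"
      using j by (auto simp: t_def k_def)
    have "?B $$ (s, j) = [?z, ?z, u_vec (Suc t), v_vec (Suc t)] ! k $ s"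
      unfolding B using tk s by (auto simp: mat_of_cols_index eval_nat_numeral)
    also have "\<dots> = A_block (Suc t) $$ (s, k)"
      unfolding A_block_def using tk(2) s by (auto simp: mat_of_cols_index)
    finally show ?thesis unfolding t_def k_def .
  qed
  have H: "dim_row H_tilde = 2" "dim_col H_tilde = 4"
    by (simp_all add: H_tilde_def mat_of_rows_list_def)
  have dim: "dim_row ?B = 3" "dim_col ?B = 20" unfolding B by simp_all
  show ?thesis
  proof (rule eq_matI)
    fix r j assume "r < dim_row (block_matrix 5 Suc)" "j < dim_col (block_matrix 5 Suc)"
    then have r: "r < 13" and j: "j < 20" by (simp_all add: block_matrix_def)
    show "H_matrix $$ (r, j) = block_matrix 5 Suc $$ (r, j)"
    proof (cases "r < 10")
      case True
      then have "r div 2 < 5" "j div 4 < 5" using j by linarith+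
      with True show ?thesis using j H dim
        by (simp add: H_matrix_def kronecker_def block_matrix_def append_rows_def del: concat.simps)
    next
      case False
      have "H_matrix $$ (r, j) = ?B $$ (r - 10, j)"
        unfolding H_matrix_def append_rows_def using False r j H dim
        by (subst index_mat_four_block) (auto simp: kronecker_def)
      also have "\<dots> = A_block (Suc (j div 4)) $$ (r - 10, j mod 4)"
        using False r j by (intro B_index) auto
      finally show ?thesis using False r j by (simp add: block_matrix_def)
    qed
  qed (simp_all add: H_matrix_def append_rows_def block_matrix_def kronecker_def H dim)
qed

lemma H_deleted_eq:
  assumes "i \<in> {1..5}"
  shows "H_deleted i = block_matrix 4 (\<lambda>t. if t < i - 1 then t + 1 else t + 2)"
proof -
  have i: "1 \<le> i" "i \<le> 5" using assms by auto
  have "card {r. r < 13 \<and> r \<in> - {2 * (i - 1)..<2 * i}} = card ({..<13} - {2 * (i - 1)..<2 * i})"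
    by (rule arg_cong[of _ _ card]) auto
  then have rows: "card {r. r < 13 \<and> r \<in> - {2 * (i - 1)..<2 * i}} = 11"
    using i by (subst (asm) card_Diff_subset) auto
  have "card {j. j < 20 \<and> j \<in> - {4 * (i - 1)..<4 * i}} = card ({..<20} - {4 * (i - 1)..<4 * i})"
    by (rule arg_cong[of _ _ card]) auto
  then have cols: "card {j. j < 20 \<and> j \<in> - {4 * (i - 1)..<4 * i}} = 16"
    using i by (subst (asm) card_Diff_subset) auto
  have dim: "dim_row (block_matrix 5 Suc) = 13" "dim_col (block_matrix 5 Suc) = 20"
    by (simp_all add: block_matrix_def)
  show ?thesis
    unfolding H_deleted_def submatrix_def H_matrix_eq dim rows cols
  proof (rule eq_matI)
    let ?b = "\<lambda>t. if t < i - 1 then t + 1 else t + 2"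
    fix r j assume "r < dim_row (block_matrix 4 ?b)" "j < dim_col (block_matrix 4 ?b)"
    then have r: "r < 11" and j: "j < 16" by (simp_all add: block_matrix_def)
    \<comment> \<open>Later rows are shifted by 2 and later columns by 4, a whole block each:
      residues stay and quotients grow by 1.\<close>
    define r' where "r' = (if r < 2 * (i - 1) then r else r + 2)"
    define j' where "j' = (if j < 4 * (i - 1) then j else j + 4)"
    have pick: "pick (- {2 * (i - 1)..<2 * i}) r = r'" "pick (- {4 * (i - 1)..<4 * i}) j = j'"
      using i by (auto simp: pick_Compl_atLeastLessThan r'_def j'_def)
    have r': "r' < 13" "r' mod 2 = r mod 2" "r' < 10 \<longleftrightarrow> r < 8" "\<not> r < 8 \<Longrightarrow> r' - 10 = r - 8"
      "r' div 2 = (if r div 2 < i - 1 then r div 2 else r div 2 + 1)"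
      using r i by (auto simp: r'_def)
    have j': "j' < 20" "j' mod 4 = j mod 4"
      "j' div 4 = (if j div 4 < i - 1 then j div 4 else j div 4 + 1)"
      using j i by (auto simp: j'_def)
    have "block_matrix 5 Suc $$ (r', j') = block_matrix 4 ?b $$ (r, j)"
      using r j r' j' by (auto simp: block_matrix_def)
    then show "mat 11 16 (\<lambda>(r, j). block_matrix 5 Suc $$ (pick (- {2 * (i - 1)..<2 * i}) r,
        pick (- {4 * (i - 1)..<4 * i}) j)) $$ (r, j) = block_matrix 4 ?b $$ (r, j)"
      using r j pick by simp
  qed (simp_all add: block_matrix_def)
qed

section \<open>Words and syndromes\<close>

lemma sum_lessThan_4: "(\<Sum>k<4. f k) = f 0 + f 1 + f 2 + f (3 :: nat)"
  for f :: "nat \<Rightarrow> 'a :: comm_monoid_add"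
  by (simp add: eval_nat_numeral)

lemma sum_lessThan_4_mult: "(\<Sum>j<4 * m. f j) = (\<Sum>t<m. \<Sum>k<4. f (4 * t + k))"
  for f :: "nat \<Rightarrow> 'a :: comm_monoid_add"
proof (induction m)
  case (Suc m)
  have "{..<4 * Suc m} = {..<4 * m} \<union> {4 * m, 4 * m + 1, 4 * m + 2, 4 * m + 3}" by auto
  then show ?case using Suc by (simp add: sum.union_disjoint ac_simps sum_lessThan_4)
qed simp

text \<open>Each block of a word lies in a coset of the inner code, whose basis is \<open>(1, 1, 1, 0)\<close>,
  \<open>(w, 1, w\<^sup>2, 1)\<close>; \<open>(x t, y t)\<close> is the syndrome of the block under \<^const>\<open>H_tilde\<close>.\<close>

definition block ::
    "(nat \<Rightarrow> gf4) \<Rightarrow> (nat \<Rightarrow> gf4) \<Rightarrow> (nat \<Rightarrow> gf4) \<Rightarrow> (nat \<Rightarrow> gf4) \<Rightarrow> nat \<Rightarrow> gf4 list" where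
  "block x y p q t = [x t + p t + w * q t, y t + p t + q t, p t + w\<^sup>2 * q t, q t]"

definition word ::
    "nat \<Rightarrow> (nat \<Rightarrow> gf4) \<Rightarrow> (nat \<Rightarrow> gf4) \<Rightarrow> (nat \<Rightarrow> gf4) \<Rightarrow> (nat \<Rightarrow> gf4) \<Rightarrow> gf4 vec" where
  "word m x y p q = vec (4 * m) (\<lambda>j. block x y p q (j div 4) ! (j mod 4))"

abbreviation inner_word :: "nat \<Rightarrow> (nat \<Rightarrow> gf4) \<Rightarrow> (nat \<Rightarrow> gf4) \<Rightarrow> gf4 vec" where
  "inner_word m \<equiv> word m (\<lambda>_. 0) (\<lambda>_. 0)"

lemma word_carrier [simp]: "word m x y p q \<in> carrier_vec (4 * m)"
  by (simp add: word_def)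

lemma dim_word [simp]: "dim_vec (word m x y p q) = 4 * m"
  by (simp add: word_def)

lemma word_index: "t < m \<Longrightarrow> k < 4 \<Longrightarrow> word m x y p q $ (4 * t + k) = block x y p q t ! k"
  by (simp add: word_def)

text \<open>The last two entries of a block determine \<open>q\<close> and then \<open>p\<close>;
  the syndromes \<open>x\<close> and \<open>y\<close> absorb what remains of the first two
  entries.\<close>

lemma word_cases:
  assumes "c \<in> carrier_vec (4 * m)"
  obtains x y p q where "c = word m x y p q"
proof
  let ?q = "\<lambda>t. c $ (4 * t + 3)"
  let ?p = "\<lambda>t. c $ (4 * t + 2) + w\<^sup>2 * ?q t"
  let ?x = "\<lambda>t. c $ (4 * t) + ?p t + w * ?q t"
  let ?y = "\<lambda>t. c $ (4 * t + 1) + ?p t + ?q t"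
  show "c = word m ?x ?y ?p ?q"
  proof (rule eq_vecI)
    fix j assume "j < dim_vec (word m ?x ?y ?p ?q)"
    moreover define t k where "t = j div 4" and "k = j mod 4"
    ultimately have tk: "t < m" "k \<in> {0, 1, 2, 3}" "j = 4 * t + k" by auto
    then have "block ?x ?y ?p ?q t ! k = c $ j"
      by (auto simp: block_def gf4_two)
    then show "c $ j = word m ?x ?y ?p ?q $ j"
      using tk word_index[of t m k] by auto
  qed (use assms in simp)
qed

lemma block_matrix_mult_index:
  assumes "c \<in> carrier_vec (4 * m)" "r < 2 * m + 3"
  shows "(block_matrix m b *\<^sub>v c) $ r =
    (\<Sum>t<m. \<Sum>k<4. block_matrix m b $$ (r, 4 * t + k) * c $ (4 * t + k))"
proof -
  have "(block_matrix m b *\<^sub>v c) $ r = (\<Sum>j<4 * m. block_matrix m b $$ (r, j) * c $ j)"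
    using assms carrier_matD[OF block_matrix_carrier[of m b]]
    by (simp add: scalar_prod_def atLeast0LessThan)
  then show ?thesis unfolding sum_lessThan_4_mult .
qed

lemma block_matrix_index:
  assumes "t < m" "k < 4"
  shows "s < m \<Longrightarrow> i < 2 \<Longrightarrow> block_matrix m b $$ (2 * s + i, 4 * t + k) =
      (if t = s then H_tilde $$ (i, k) else 0)"
    and "i < 3 \<Longrightarrow> block_matrix m b $$ (2 * m + i, 4 * t + k) = A_block (b t) $$ (i, k)"
  using assms by (auto simp: block_matrix_def)

text \<open>The inner basis vectors are in the kernel of \<open>H_tilde\<close> since 1 + w + w^2 =
  0, and \<open>x\<close>, \<open>y\<close> sit on its identity columns.\<close>

lemma block_matrix_word_local:
  assumes "s < m" "i < 2"
  shows "(block_matrix m b *\<^sub>v word m x y p q) $ (2 * s + i) = [x s, y s] ! i"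
proof -
  have cancel: "x + p + w * q + (p + w\<^sup>2 * q) + q = x" "y + p + q + (p + w\<^sup>2 * q) + w * q = y"
    for x y p q by (cases x; cases y; cases p; cases q; simp add: gf4_arith)+
  have "(block_matrix m b *\<^sub>v word m x y p q) $ (2 * s + i) =
      (\<Sum>t<m. \<Sum>k<4. (if t = s then H_tilde $$ (i, k) else 0) * block x y p q t ! k)"
    using assms block_matrix_index(1)[of _ m _ s i b]
    by (subst block_matrix_mult_index) (auto simp: word_index intro!: sum.cong)
  also have "\<dots> = (\<Sum>t<m. if t = s then \<Sum>k<4. H_tilde $$ (i, k) * block x y p q s ! k else 0)"
    by (intro sum.cong) auto
  also have "\<dots> = (\<Sum>k<4. H_tilde $$ (i, k) * block x y p q s ! k)"
    using assms by simp
  also have "\<dots> = [x s, y s] ! i"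
  proof -
    have "i \<in> {0, 1}" using assms(2) by auto
    then show ?thesis
      unfolding sum_lessThan_4 using cancel by (auto simp: H_tilde_index block_def)
  qed
  finally show ?thesis .
qed

text \<open>The third entry of a block contributes w^2 q u_i, which cancels against the same term in
  q v_i. So \<open>q\<close> is seen only by the middle row and \<open>p\<close> only by the other
  two; the syndromes meet zero columns.\<close>

lemma block_matrix_word_global:
  assumes "\<And>t. t < m \<Longrightarrow> b t \<in> {1..5}" "i < 3"
  shows "(block_matrix m b *\<^sub>v word m x y p q) $ (2 * m + i) =
    [\<Sum>t<m. alpha (b t) * p t, \<Sum>t<m. q t, \<Sum>t<m. beta (b t) * p t] ! i"
proof -
  have cancel: "a * (p + w\<^sup>2 * q) + w\<^sup>2 * a * q = a * p" for a p q
    by (cases a; cases p; cases q; simp add: gf4_arith)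
  have "(block_matrix m b *\<^sub>v word m x y p q) $ (2 * m + i) =
      (\<Sum>t<m. \<Sum>k<4. A_block (b t) $$ (i, k) * block x y p q t ! k)"
    using assms(2) by (subst block_matrix_mult_index)
      (auto simp: word_index block_matrix_index intro!: sum.cong)
  also have "\<dots> = (\<Sum>t<m. [alpha (b t) * p t, q t, beta (b t) * p t] ! i)"
  proof (intro sum.cong refl)
    fix t assume "t \<in> {..<m}"
    then have bt: "b t \<in> {1..5}" using assms(1) by simp
    have "i \<in> {0, 1, 2}" using assms(2) by auto
    then show "(\<Sum>k<4. A_block (b t) $$ (i, k) * block x y p q t ! k) =
        [alpha (b t) * p t, q t, beta (b t) * p t] ! i"
      unfolding sum_lessThan_4 using cancel by (auto simp: A_block_index[OF bt] block_def)
  qed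
  also have "\<dots> = [\<Sum>t<m. alpha (b t) * p t, \<Sum>t<m. q t, \<Sum>t<m. beta (b t) * p t] ! i"
  proof -
    have "i \<in> {0, 1, 2}" using assms(2) by auto
    then show ?thesis by auto
  qed
  finally show ?thesis .
qed

section \<open>The codes with a block parity-check matrix\<close>

lemma hamming_weight_word:
  "hamming_weight (word m x y p q) = (\<Sum>t<m. \<Sum>k<4. of_bool (block x y p q t ! k \<noteq> 0))"
proof -
  have "hamming_weight (word m x y p q) = (\<Sum>j<4 * m. of_bool (word m x y p q $ j \<noteq> 0))"
    unfolding hamming_weight_def
    by (subst sum_of_bool_eq) (auto intro!: arg_cong[of _ _ card])
  then show ?thesis unfolding sum_lessThan_4_mult by (simp add: word_index)
qed

text \<open>Weight of the inner codeword a (1,1,1,0) + b (w,1,w^2,1).\<close>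

definition inner_weight :: "gf4 \<Rightarrow> gf4 \<Rightarrow> nat" where
  "inner_weight a b = of_bool (a + w * b \<noteq> 0) + of_bool (a + b \<noteq> 0) +
    of_bool (a + w\<^sup>2 * b \<noteq> 0) + of_bool (b \<noteq> 0)"

lemma inner_weight_0 [simp]: "inner_weight 0 0 = 0"
  by (simp add: inner_weight_def)

text \<open>The four coordinates are pairwise independent linear forms in \<open>a\<close> and
  \<open>b\<close>, so at most one vanishes on a nonzero pair.\<close>

lemma inner_weight_ge_3: "a \<noteq> 0 \<or> b \<noteq> 0 \<Longrightarrow> 3 \<le> inner_weight a b"
  by (cases a; cases b) (simp_all add: inner_weight_def gf4_arith)

lemma inner_weight_0_left: "b \<noteq> 0 \<Longrightarrow> inner_weight 0 b = 4"
  by (cases b) (simp_all add: inner_weight_def gf4_arith)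

lemma sum_block_inner:
  "(\<Sum>k<4. of_bool (block (\<lambda>_. 0) (\<lambda>_. 0) p q t ! k \<noteq> 0)) = inner_weight (p t) (q t)"
  by (simp add: sum_lessThan_4 block_def inner_weight_def eval_nat_numeral)

lemma hamming_weight_inner_word:
  "hamming_weight (inner_word m p q) = (\<Sum>t<m. inner_weight (p t) (q t))"
  unfolding hamming_weight_word sum_block_inner ..

text \<open>Covers both lengths, \<open>m = 5\<close> and \<open>m = 4\<close>. Distinct block
  numbers make any two of the vectors (alpha, beta) independent.\<close>

locale block_code =
  fixes m :: nat and b :: "nat \<Rightarrow> nat"
  assumes m: "4 \<le> m"
    and b_range: "t < m \<Longrightarrow> b t \<in> {1..5}"
    and b_neq: "s < m \<Longrightarrow> t < m \<Longrightarrow> s \<noteq> t \<Longrightarrow> b s \<noteq> b t"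
begin

text \<open>The outer codes: the conditions on \<open>p\<close> give an [m, m-2, 3] code, for
  \<open>m = 5\<close> the quaternary Hamming code; the one on \<open>q\<close> gives the single
  parity check code.\<close>

definition checks :: "(nat \<Rightarrow> gf4) \<Rightarrow> (nat \<Rightarrow> gf4) \<Rightarrow> bool" where
  "checks p q \<longleftrightarrow> (\<Sum>t<m. alpha (b t) * p t) = 0 \<and> (\<Sum>t<m. beta (b t) * p t) = 0 \<and>
    (\<Sum>t<m. q t) = 0"

abbreviation "C \<equiv> mat_kernel (block_matrix m b)"

text \<open>Serves twice: \<open>z = 0\<close> yields codewords, and arbitrary \<open>z\<close>
  yields surjectivity of the parity-check matrix.\<close>

lemma block_matrix_mult_word_eqI:
  assumes z: "z \<in> carrier_vec (2 * m + 3)"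
    and "\<And>t i. t < m \<Longrightarrow> i < 2 \<Longrightarrow> z $ (2 * t + i) = [x t, y t] ! i"
    and "\<And>i. i < 3 \<Longrightarrow> z $ (2 * m + i) =
      [\<Sum>t<m. alpha (b t) * p t, \<Sum>t<m. q t, \<Sum>t<m. beta (b t) * p t] ! i"
  shows "block_matrix m b *\<^sub>v word m x y p q = z"
proof (rule eq_vecI)
  fix r assume "r < dim_vec z"
  then have r: "r < 2 * m + 3" using z by simp
  show "(block_matrix m b *\<^sub>v word m x y p q) $ r = z $ r"
  proof (cases "r < 2 * m")
    case True
    then have "r div 2 < m" "r mod 2 < 2" by auto
    then have "(block_matrix m b *\<^sub>v word m x y p q) $ (2 * (r div 2) + r mod 2) =
        z $ (2 * (r div 2) + r mod 2)"
      by (simp only: assms(2) block_matrix_word_local)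
    then show ?thesis by simp
  next
    case False
    then have "r - 2 * m < 3" using r by auto
    then have "(block_matrix m b *\<^sub>v word m x y p q) $ (2 * m + (r - 2 * m)) =
        z $ (2 * m + (r - 2 * m))"
      by (simp only: assms(3) block_matrix_word_global[OF b_range])
    then show ?thesis using False by simp
  qed
qed (use z carrier_matD[OF block_matrix_carrier[of m b]] in simp)

section \<open>Codewords as pairs of outer words\<close>

lemma inner_word_in_C:
  assumes "checks p q"
  shows "inner_word m p q \<in> C"
proof (rule mat_kernelI[OF block_matrix_carrier word_carrier block_matrix_mult_word_eqI])
  fix t i :: nat assume "t < m" "i < 2"
  then show "0\<^sub>v (2 * m + 3) $ (2 * t + i) = [0, 0] ! i" by (auto simp: less_2_cases_iff)
next
  fix i :: nat assume "i < 3"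
  then have "i \<in> {0, 1, 2}" by auto
  then show "0\<^sub>v (2 * m + 3) $ (2 * m + i) =
      [\<Sum>t<m. alpha (b t) * p t, \<Sum>t<m. q t, \<Sum>t<m. beta (b t) * p t] ! i"
    using assms by (auto simp: checks_def)
qed simp

lemma C_cases:
  assumes "c \<in> C"
  obtains p q where "checks p q" "c = inner_word m p q"
proof -
  obtain x y p q where c: "c = word m x y p q"
    using mat_kernelD(1)[OF block_matrix_carrier assms] word_cases by metis
  have 0: "block_matrix m b *\<^sub>v word m x y p q = 0\<^sub>v (2 * m + 3)"
    using mat_kernelD(2)[OF block_matrix_carrier assms] c by simp
  have xy: "x t = 0" "y t = 0" if "t < m" for t
    using that block_matrix_word_local[of t m 0 b x y p q]
      block_matrix_word_local[of t m 1 b x y p q] unfolding 0 by auto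
  have "checks p q"
    using block_matrix_word_global[of m b 0 x y p q] block_matrix_word_global[of m b 1 x y p q]
      block_matrix_word_global[of m b 2 x y p q] b_range unfolding 0 checks_def by simp
  \<comment> \<open>The syndromes are known to vanish only below \<open>m\<close>, which is all that
    \<open>word\<close> reads.\<close>
  moreover have "c = inner_word m p q"
    unfolding c word_def using xy by (intro eq_vecI) (auto simp: block_def)
  ultimately show ?thesis by (rule that)
qed

lemma sum_eq_sum_subset:
  assumes "S \<subseteq> {..<m}" "\<And>t. t < m \<Longrightarrow> t \<notin> S \<Longrightarrow> f t = 0"
  shows "(\<Sum>t<m. f t) = (\<Sum>t\<in>S. f t)"
  using assms by (intro sum.mono_neutral_right) auto

text \<open>For full rank, the first \<open>2 * m\<close> entries of \<open>z\<close> are prescribed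
  through the syndromes, the middle one of the last three through \<open>q\<close> in block 0, the
  other two through \<open>p\<close> in blocks 0 and 1.\<close>

lemma dim_C: "code_dim (4 * m) C + (2 * m + 3) = 4 * m"
proof (rule code_dim_mat_kernel[OF block_matrix_carrier])
  fix z :: "gf4 vec" assume z: "z \<in> carrier_vec (2 * m + 3)"
  have b01: "b 0 \<in> {1..5}" "b 1 \<in> {1..5}" "b 0 \<noteq> b 1"
    using m b_range b_neq[of 0 1] by auto
  obtain p0 p1 where p01: "alpha (b 0) * p0 + alpha (b 1) * p1 = z $ (2 * m)"
      "beta (b 0) * p0 + beta (b 1) * p1 = z $ (2 * m + 2)"
    using alpha_beta_solve[OF b01] by metis
  define p where "p = (\<lambda>_ :: nat. 0)(0 := p0, 1 := p1)"
  define q where "q = (\<lambda>_ :: nat. 0)(0 := z $ (2 * m + 1))"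
  have "block_matrix m b *\<^sub>v word m (\<lambda>t. z $ (2 * t)) (\<lambda>t. z $ (2 * t + 1)) p q = z"
  proof (rule block_matrix_mult_word_eqI[OF z])
    fix i :: nat assume "i < 3"
    then have "i \<in> {0, 1, 2}" by auto
    moreover have "(\<Sum>t<m. f (b t) * p t) = f (b 0) * p0 + f (b 1) * p1" for f :: "nat \<Rightarrow> gf4"
      using m by (subst sum_eq_sum_subset[of "{0, 1}"]) (auto simp: p_def)
    moreover have "(\<Sum>t<m. q t) = z $ (2 * m + 1)"
      using m by (subst sum_eq_sum_subset[of "{0}"]) (auto simp: q_def)
    ultimately show "z $ (2 * m + i) =
        [\<Sum>t<m. alpha (b t) * p t, \<Sum>t<m. q t, \<Sum>t<m. beta (b t) * p t] ! i"
      using p01 by auto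
  qed (auto simp: less_2_cases_iff)
  then show "\<exists>c\<in>carrier_vec (4 * m). block_matrix m b *\<^sub>v c = z"
    using word_carrier by blast
qed

text \<open>The outer code of the words \<open>p\<close> has minimum distance at least 3.\<close>

lemma two_supported_eq_0:
  assumes "checks p q" "s < m" "t < m" "s \<noteq> t"
    and "\<And>u. u < m \<Longrightarrow> u \<noteq> s \<Longrightarrow> u \<noteq> t \<Longrightarrow> p u = 0"
  shows "p s = 0"
proof -
  have st: "(\<Sum>u<m. f (b u) * p u) = f (b s) * p s + f (b t) * p t" for f :: "nat \<Rightarrow> gf4"
    using assms by (subst sum_eq_sum_subset[of "{s, t}"]) auto
  have a: "alpha (b s) * p s = alpha (b t) * p t" and bb: "beta (b s) * p s = beta (b t) * p t"
    using assms(1) unfolding checks_def st gf4_add_eq_0_iff by auto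
  \<comment> \<open>Eliminating \<open>p t\<close> from the two checks leaves \<open>p s\<close>
    times the nonzero determinant.\<close>
  have "(alpha (b s) * beta (b t) + alpha (b t) * beta (b s)) * p s =
      beta (b t) * (alpha (b s) * p s) + alpha (b t) * (beta (b s) * p s)"
    by (simp only: algebra_simps)
  also have "\<dots> = beta (b t) * (alpha (b t) * p t) + alpha (b t) * (beta (b t) * p t)"
    unfolding a bb ..
  also have "\<dots> = 0" by (simp add: gf4_two)
  finally show ?thesis
    using alpha_beta_det[OF b_range[OF assms(2)] b_range[OF assms(3)] b_neq[OF assms(2-4)]] by simp
qed

section \<open>Minimum distance of the concatenated code\<close>

lemma weight_ge_8:
  assumes "checks p q" "hamming_weight (inner_word m p q) \<noteq> 0"
  shows "8 \<le> hamming_weight (inner_word m p q)"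
proof -
  let ?W = "\<lambda>t. inner_weight (p t) (q t)"
  have le: "sum ?W S \<le> hamming_weight (inner_word m p q)" if "S \<subseteq> {..<m}" for S
    unfolding hamming_weight_inner_word using that by (intro sum_mono2) auto
  show ?thesis
  proof (cases "\<exists>s<m. p s \<noteq> 0")
    case True
    then obtain s where s: "s < m" "p s \<noteq> 0" by auto
    \<comment> \<open>An auxiliary second index, needed to apply \<open>two_supported_eq_0\<close>
      when the support of \<open>p\<close> would be just {s}.\<close>
    have "(if s = 0 then 1 else 0) < m" "(if s = 0 then 1 else 0) \<noteq> s" using m by auto
    then obtain t where t: "t < m" "t \<noteq> s" "p t \<noteq> 0"
      using two_supported_eq_0[OF assms(1) s(1)] s(2) by metis
    obtain u where u: "u < m" "u \<noteq> s" "u \<noteq> t" "p u \<noteq> 0"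
      using two_supported_eq_0[OF assms(1) s(1) t(1)] t(2) s(2) by metis
    have "9 \<le> ?W s + ?W t + ?W u"
      using inner_weight_ge_3[of "p s" "q s"] inner_weight_ge_3[of "p t" "q t"]
        inner_weight_ge_3[of "p u" "q u"] s t u by linarith
    also have "\<dots> = sum ?W {s, t, u}" using t u by auto
    also have "\<dots> \<le> hamming_weight (inner_word m p q)" using s t u by (intro le) auto
    finally show ?thesis by simp
  next
    case False
    then have p: "p t = 0" if "t < m" for t using that by auto
    obtain s where s: "s < m" "q s \<noteq> 0"
      using assms(2) p unfolding hamming_weight_inner_word
      by (metis (no_types, lifting) inner_weight_0 lessThan_iff sum.neutral)
    obtain t where t: "t < m" "t \<noteq> s" "q t \<noteq> 0"
    proof (rule ccontr)
      assume "\<not> thesis"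
      then have "(\<Sum>t<m. q t) = q s"
        using that s by (subst sum_eq_sum_subset[of "{s}"]) auto
      then show False using assms(1) s(2) by (simp add: checks_def)
    qed
    have "8 = sum ?W {s, t}" using s t p by (simp add: inner_weight_0_left)
    also have "\<dots> \<le> hamming_weight (inner_word m p q)" using s t by (intro le) auto
    finally show ?thesis .
  qed
qed

text \<open>Codewords of minimum weight; they also separate coordinates in different blocks.\<close>

definition pair_word :: "nat \<Rightarrow> nat \<Rightarrow> gf4 vec" where
  "pair_word s t = inner_word m (\<lambda>_. 0) ((\<lambda>_. 0)(s := 1, t := 1))"

lemma pair_word_in_C:
  assumes "s < m" "t < m" "s \<noteq> t"
  shows "pair_word s t \<in> C"
proof -
  have "(\<Sum>u<m. ((\<lambda>_. 0)(s := 1, t := 1)) u) = (\<Sum>u\<in>{s, t}. ((\<lambda>_. 0)(s := 1, t := 1)) u :: gf4)"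
    using assms by (intro sum_eq_sum_subset) auto
  then show ?thesis
    unfolding pair_word_def using assms by (intro inner_word_in_C) (auto simp: checks_def)
qed

lemma hamming_weight_pair_word:
  assumes "s < m" "t < m" "s \<noteq> t"
  shows "hamming_weight (pair_word s t) = 8"
  unfolding pair_word_def hamming_weight_inner_word using assms
  by (subst sum_eq_sum_subset[of "{s, t}"]) (auto simp: inner_weight_0_left)

lemma min_distance_C: "min_distance C = 8"
proof -
  have "pair_word 0 1 \<in> C" "hamming_weight (pair_word 0 1) = 8"
    using m by (auto intro!: pair_word_in_C hamming_weight_pair_word)
  moreover from this have "pair_word 0 1 \<noteq> 0\<^sub>v (dim_vec (pair_word 0 1))"
    using hamming_weight_eq_0_iff by (metis zero_neq_numeral)
  moreover have "8 \<le> hamming_weight c" if "c \<in> C" "c \<noteq> 0\<^sub>v (dim_vec c)" for c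
    using that weight_ge_8 C_cases hamming_weight_eq_0_iff by metis
  ultimately show ?thesis
    unfolding min_distance_def by (intro cInf_eq_minimum) force+
qed

section \<open>Locality: r = 2 is attained, r = 1 is not\<close>

lemma LRC_C: "LRC (4 * m) 2 3 C"
  unfolding LRC_def
proof (intro conjI ballI)
  show "linear_code (4 * m) C" by (rule linear_code_mat_kernel[OF block_matrix_carrier])
next
  fix i assume "i \<in> {0..<4 * m}"
  define t where "t = i div 4"
  \<comment> \<open>The repair set is the block of \<open>i\<close>: it has the permitted size 4,
    and codewords restrict to inner codewords on it.\<close>
  let ?R = "{4 * t..<4 * t + 4}"
  have t: "t < m" "i \<in> ?R" using \<open>i \<in> {0..<4 * m}\<close> by (auto simp: t_def)
  have "min_distance_ge (restrict_code C ?R) 3"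
    unfolding min_distance_ge_iff restrict_code_def ball_simps
  proof
    fix c assume "c \<in> C"
    then obtain p q where c: "c = inner_word m p q" by (rule C_cases)
    have "hamming_weight (subvec c ?R) = card {i\<in>?R. c $ i \<noteq> 0}"
      using t(1) by (intro hamming_weight_subvec) (auto simp: c)
    also have "\<dots> = (\<Sum>i\<in>?R. of_bool (c $ i \<noteq> 0))"
      by (subst sum_of_bool_eq) (auto intro!: arg_cong[of _ _ card])
    also have "\<dots> = (\<Sum>k<4. of_bool (c $ (4 * t + k) \<noteq> 0))"
      using sum.shift_bounds_nat_ivl[of "\<lambda>i. of_bool (c $ i \<noteq> 0)" 0 "4 * t" 4]
      by (simp add: atLeast0LessThan ac_simps del: sum_of_bool_eq)
    also have "\<dots> = inner_weight (p t) (q t)"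
      using t(1) by (simp add: c word_index flip: sum_block_inner)
    finally show "hamming_weight (subvec c ?R) = 0 \<or> 3 \<le> hamming_weight (subvec c ?R)"
      using inner_weight_ge_3 inner_weight_0 by metis
  qed
  with t show "\<exists>R\<subseteq>{0..<4 * m}. i \<in> R \<and> card R \<le> 2 + 3 - 1 \<and> min_distance_ge (restrict_code C R) 3"
    by (intro exI[of _ ?R]) auto
qed

text \<open>If \<open>j\<close> shares block 0, an inner word vanishing at \<open>j\<close> is
  extended to a codeword; otherwise a \<open>pair_word\<close> avoids the block of
  \<open>j\<close>.\<close>

lemma ex_codeword_separating:
  assumes "0 < j" "j < 4 * m"
  shows "\<exists>c\<in>C. c $ 0 \<noteq> 0 \<and> c $ j = 0"
proof (cases "j < 4")
  case True
  then have j: "j \<in> {1, 2, 3}" using assms(1) by auto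
  \<comment> \<open>The inner word of \<open>(p0, q0)\<close> vanishes at \<open>j\<close> and not
    at 0. The head of each list is a dummy, as \<open>j\<close> is positive.\<close>
  define p0 :: gf4 where "p0 = [0, 1, w\<^sup>2, 1] ! j"
  define q0 :: gf4 where "q0 = [0, 1, 1, 0] ! j"
  have b12: "b 1 \<in> {1..5}" "b 2 \<in> {1..5}" "b 1 \<noteq> b 2"
    using m b_range b_neq[of 1 2] by auto
  \<comment> \<open>Blocks 1 and 2 compensate the contribution of block 0 to the checks on
    \<open>p\<close>; a second \<open>q0\<close> in block 1 does so for \<open>q\<close>.\<close>
  obtain p1 p2 where p12: "alpha (b 1) * p1 + alpha (b 2) * p2 = alpha (b 0) * p0"
      "beta (b 1) * p1 + beta (b 2) * p2 = beta (b 0) * p0"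
    using alpha_beta_solve[OF b12] by metis
  define p where "p = (\<lambda>_ :: nat. 0)(0 := p0, 1 := p1, 2 := p2)"
  define q where "q = (\<lambda>_ :: nat. 0)(0 := q0, 1 := q0)"
  have "(\<Sum>t<m. f (b t) * p t) = f (b 0) * p0 + (f (b 1) * p1 + f (b 2) * p2)" for f :: "nat \<Rightarrow> gf4"
    using m by (subst sum_eq_sum_subset[of "{0, 1, 2}"]) (auto simp: p_def)
  moreover have "(\<Sum>t<m. q t) = q0 + q0"
    using m by (subst sum_eq_sum_subset[of "{0, 1}"]) (auto simp: q_def)
  ultimately have "checks p q"
    using p12 by (simp add: checks_def)
  then have "inner_word m p q \<in> C" by (rule inner_word_in_C)
  moreover have "inner_word m p q $ k = [p0 + w * q0, p0 + q0, p0 + w\<^sup>2 * q0, q0] ! k" if "k < 4" for k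
    using word_index[of 0 m k] that m by (simp add: block_def p_def q_def)
  then have "inner_word m p q $ 0 \<noteq> 0" "inner_word m p q $ j = 0"
    using j by (auto simp: p0_def q0_def gf4_arith)
  ultimately show ?thesis by blast
next
  case False
  \<comment> \<open>Any block other than 0 and that of \<open>j\<close>.\<close>
  define s :: nat where "s = (if j div 4 = 1 then 2 else 1)"
  have s: "s < m" "s \<noteq> 0" "s \<noteq> j div 4" using m by (auto simp: s_def)
  have "pair_word 0 s \<in> C" using s m by (intro pair_word_in_C) auto
  moreover have "pair_word 0 s $ 0 \<noteq> 0"
    using m s by (simp add: pair_word_def word_def block_def gf4_arith)
  moreover have "pair_word 0 s $ j = 0"
  proof -
    have "j mod 4 \<in> {0, 1, 2, 3}" by auto
    then show ?thesis
      using False assms(2) s by (auto simp: pair_word_def word_def block_def)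
  qed
  ultimately show ?thesis by blast
qed

lemma not_LRC_C_1: "\<not> LRC (4 * m) 1 3 C"
proof
  assume "LRC (4 * m) 1 3 C"
  moreover have "0 \<in> {0..<4 * m}" using m by simp
  ultimately obtain R where R: "R \<subseteq> {0..<4 * m}" "0 \<in> R" "card R \<le> 3"
      "min_distance_ge (restrict_code C R) 3"
    unfolding LRC_def by (auto dest!: bspec[of _ _ 0])
  have fin: "finite R" using R(1) finite_subset by blast
  \<comment> \<open>Such a word has positive weight on \<open>R\<close>, hence weight at least 3; as
    \<open>R\<close> has at most 3 elements, it vanishes nowhere on \<open>R\<close>.\<close>
  have full: "{i\<in>R. c $ i \<noteq> 0} = R \<and> 3 \<le> card R" if c: "c \<in> C" "c $ 0 \<noteq> 0" for c
  proof -
    have "dim_vec c = 4 * m" using mat_kernelD(1)[OF block_matrix_carrier c(1)] by simp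
    then have "hamming_weight (subvec c R) = card {i\<in>R. c $ i \<noteq> 0}"
      using R(1) by (intro hamming_weight_subvec) simp
    moreover have "0 \<in> {i\<in>R. c $ i \<noteq> 0}" using R(2) c by simp
    then have "card {i\<in>R. c $ i \<noteq> 0} \<noteq> 0" using fin by auto
    ultimately have "3 \<le> card {i\<in>R. c $ i \<noteq> 0}"
      using R(4) c(1) unfolding min_distance_ge_iff restrict_code_def by auto
    then show ?thesis
      using R(3) card_seteq[OF fin, of "{i\<in>R. c $ i \<noteq> 0}"] by auto
  qed
  \<comment> \<open>Any codeword nonzero at 0 forces three elements in \<open>R\<close>, so
    \<open>R\<close> contains some other coordinate \<open>j\<close>.\<close>
  obtain c where "c \<in> C" "c $ 0 \<noteq> 0" using ex_codeword_separating[of 1] m by auto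
  then have "3 \<le> card R" using full by blast
  then have "\<not> R \<subseteq> {0}" using card_mono[of "{0}" R] by auto
  then obtain j where j: "j \<in> R" "j \<noteq> 0" by auto
  then have "0 < j" "j < 4 * m" using R(1) by auto
  then obtain c where "c \<in> C" "c $ 0 \<noteq> 0" "c $ j = 0"
    using ex_codeword_separating by blast
  then show False using full j(1) by blast
qed

section \<open>Optimality for both lengths\<close>

theorem optimal_LRC_C: "optimal_LRC (4 * m) (2 * m - 3) 8 2 3 C"
proof -
  have "nkd_code (4 * m) (2 * m - 3) 8 C"
    unfolding nkd_code_def
    using linear_code_mat_kernel[OF block_matrix_carrier] dim_C min_distance_C by auto
  \<comment> \<open>Here k/r = m - 3/2. With ceiling m - 1 the bound reads 4m - (2m - 3) + 1 - 2(m -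
    2) = 8, independently of \<open>m\<close>.\<close>
  moreover have "\<lceil>real (2 * m - 3) / real 2\<rceil> = int m - 1"
    using m by (intro ceiling_unique) (auto simp: of_nat_diff)
  then have "d_optimal (4 * m) (2 * m - 3) 8 2 3"
    unfolding d_optimal_def using m by simp
  moreover have "r_optimal (4 * m) 2 3 C"
    unfolding r_optimal_def
  proof (intro allI impI)
    fix r' :: nat assume "1 \<le> r' \<and> r' < 2"
    then have "r' = 1" by auto
    then show "\<not> LRC (4 * m) r' 3 C" using not_LRC_C_1 by simp
  qed
  ultimately show ?thesis
    unfolding optimal_LRC_def using LRC_C m by auto
qed

end

theorem mainTheorem10:
  shows "optimal_LRC 20 7 8 2 3 (mat_kernel H_matrix) \<and>
    (\<forall>i\<in>{1..5}. optimal_LRC 16 5 8 2 3 (mat_kernel (H_deleted i)))"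
proof (intro conjI ballI)
  interpret block_code 5 Suc
    by unfold_locales auto
  show "optimal_LRC 20 7 8 2 3 (mat_kernel H_matrix)"
    using optimal_LRC_C unfolding H_matrix_eq by simp
next
  fix i :: nat assume i: "i \<in> {1..5}"
  interpret block_code 4 "\<lambda>t. if t < i - 1 then t + 1 else t + 2"
    using i by unfold_locales auto
  show "optimal_LRC 16 5 8 2 3 (mat_kernel (H_deleted i))"
    using optimal_LRC_C unfolding H_deleted_eq[OF i] by simp
qed

end
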